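(* For every integer $n\ge 2$ with $n\ne 3$, there exists a covering circuit of $G_n^2$ whose link length equals the minimum link length of a covering trail of $G_n^2$ (that is, $3$ if $n=2$ and $2(n-1)$ if $n\ge 4$).
   Context: For a positive integer $n$, let $G_n^2=\{0,1,\ldots,n-1\}\times\{0,1,\ldots,n-1\}\subset\mathbb{R}^2$. A covering trail of $G_n^2$ is a directed polygonal chain in $\mathbb{R}^2$ (a finite sequence of points, consecutive ones joined by line segments called edges) that passes through every point of $G_n^2$ at least once, in which no edge is repeated and no two consecutive edges are collinear; its vertices need not be grid points. A covering circuit is a covering trail whose starting point equals its endpoint (grid points may be visited more than once). The link length of a trail is its number of edges. It is known that the minimum link length of a covering trail of $G_n^2$ is $1$ for $n=1$, $3$ for $n=2$, and $2(n-1)$ for $n\ge 3$. *)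

theory Defs
  imports "HOL-Analysis.Analysis"
begin

definition grid :: "nat \<Rightarrow> (real \<times> real) set" where
  "grid n = {(real i, real j) | i j. i < n \<and> j < n}"

text \<open>
  A polygonal chain is given by the list of its vertices. Its edges are closed segments,
  so an edge traversed again in the opposite direction counts as repeated.
\<close>

definition edges :: "(real \<times> real) list \<Rightarrow> (real \<times> real) set list" where
  "edges ps = map (\<lambda>i. closed_segment (ps ! i) (ps ! Suc i)) [0..<length ps - 1]"

definition link_length :: "(real \<times> real) list \<Rightarrow> nat" where
  "link_length ps = length (edges ps)"

definition polygonal_chain :: "(real \<times> real) list \<Rightarrow> bool" where
  "polygonal_chain ps \<longleftrightarrow> 2 \<le> length ps \<and> (\<forall>i. Suc i < length ps \<longrightarrow> ps ! i \<noteq> ps ! Suc i)"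

definition covering_trail :: "nat \<Rightarrow> (real \<times> real) list \<Rightarrow> bool" where
  "covering_trail n ps \<longleftrightarrow>
     polygonal_chain ps \<and>
     grid n \<subseteq> \<Union> (set (edges ps)) \<and>
     distinct (edges ps) \<and>
     (\<forall>i. Suc i < length (edges ps) \<longrightarrow> \<not> collinear (edges ps ! i \<union> edges ps ! Suc i))"

definition covering_circuit :: "nat \<Rightarrow> (real \<times> real) list \<Rightarrow> bool" where
  "covering_circuit n ps \<longleftrightarrow> covering_trail n ps \<and> hd ps = last ps"

definition min_link_length :: "nat \<Rightarrow> nat" where
  "min_link_length n = (LEAST k. \<exists>ps. covering_trail n ps \<and> link_length ps = k)"

end

theory Submission imports Defs begin

text \<open>
  Lower bound: let \<open>A\<close> and \<open>B\<close> be the sets of rows and columns that contain no edge. If one of them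
  is empty, there are \<open>n\<close> parallel edges, no two of them consecutive, hence at least \<open>2n - 1\<close> edges.
  Otherwise \<open>B \<times> A\<close> is covered by slanted edges, each of which meets the boundary of \<open>B \<times> A\<close> at most
  twice, so that \<open>|A| + |B| - 2\<close> of them are needed besides the \<open>n - |A|\<close> horizontal and
  \<open>n - |B|\<close> vertical edges.

  Upper bound: start from explicit circuits for \<open>n = 4, 5\<close> that leave the upper right corner of the
  grid along the diagonal and return to it upwards along the last column. Such a circuit can be
  opened at that corner and extended by one turn around the square: four more edges for \<open>n + 2\<close>.
\<close>

section \<open>Segments in the plane\<close>

text \<open>The equation puts the point on the line; both coordinate ranges are kept because on an
  axis-parallel segment one of them does not bound the parameter. This division-free form lets
  \<open>simp\<close> decide membership for explicit points.\<close>

lemma mem_closed_segment_prod_iff: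
  fixes x y x1 y1 x2 y2 :: real
  shows "(x, y) \<in> closed_segment (x1, y1) (x2, y2) \<longleftrightarrow>
    (x2 - x1) * (y - y1) = (y2 - y1) * (x - x1) \<and>
    x \<in> closed_segment x1 x2 \<and> y \<in> closed_segment y1 y2"
proof
  assume "(x, y) \<in> closed_segment (x1, y1) (x2, y2)"
  then obtain u where u: "0 \<le> u" "u \<le> 1" "x = (1 - u) * x1 + u * x2" "y = (1 - u) * y1 + u * y2"
    by (auto simp: closed_segment_def)
  then have "x - x1 = u * (x2 - x1)" "y - y1 = u * (y2 - y1)"
    by (auto simp: algebra_simps)
  with u show "(x2 - x1) * (y - y1) = (y2 - y1) * (x - x1) \<and>
    x \<in> closed_segment x1 x2 \<and> y \<in> closed_segment y1 y2"
    by (auto simp: closed_segment_def)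
next
  assume *: "(x2 - x1) * (y - y1) = (y2 - y1) * (x - x1) \<and>
    x \<in> closed_segment x1 x2 \<and> y \<in> closed_segment y1 y2"
  then obtain u v where u: "0 \<le> u" "u \<le> 1" "x = (1 - u) * x1 + u * x2"
    and v: "0 \<le> v" "v \<le> 1" "y = (1 - v) * y1 + v * y2"
    by (auto simp: closed_segment_def)
  have d: "x - x1 = u * (x2 - x1)" "y - y1 = v * (y2 - y1)"
    using u v by (auto simp: algebra_simps)
  \<comment> \<open>The parameters \<open>u\<close> and \<open>v\<close> found for the two
    coordinates agree unless the segment is axis-parallel.\<close>
  with * have "(x2 - x1) * (y2 - y1) * (v - u) = 0"
    by (simp add: algebra_simps)
  then consider "x1 = x2" | "y1 = y2" | "u = v" by auto
  then show "(x, y) \<in> closed_segment (x1, y1) (x2, y2)"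
  proof cases
    case 1
    with u v show ?thesis
      by (auto simp: closed_segment_def algebra_simps intro!: exI[of _ v])
  next
    case 2
    with u v show ?thesis
      by (auto simp: closed_segment_def algebra_simps intro!: exI[of _ u])
  next
    case 3
    with u v show ?thesis
      by (auto simp: closed_segment_def intro!: exI[of _ u])
  qed
qed

lemma collinear_fst_const: "(\<And>p. p \<in> S \<Longrightarrow> fst p = c) \<Longrightarrow> collinear (S :: (real \<times> real) set)"
  unfolding collinear_def
  by (rule exI[of _ "(0, 1)"]) (auto simp: prod_eq_iff)

lemma collinear_snd_const: "(\<And>p. p \<in> S \<Longrightarrow> snd p = c) \<Longrightarrow> collinear (S :: (real \<times> real) set)"
  unfolding collinear_def
  by (rule exI[of _ "(1, 0)"]) (auto simp: prod_eq_iff)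

lemma collinear_imp_cross_eq_0:
  fixes x1 y1 x2 y2 x3 y3 :: real
  assumes "collinear S" "(x1, y1) \<in> S" "(x2, y2) \<in> S" "(x3, y3) \<in> S"
  shows "(x2 - x1) * (y3 - y1) = (y2 - y1) * (x3 - x1)"
proof -
  obtain u where u: "\<And>p q. p \<in> S \<Longrightarrow> q \<in> S \<Longrightarrow> \<exists>c. p - q = c *\<^sub>R u"
    using assms(1) unfolding collinear_def by blast
  obtain c d where "(x2, y2) - (x1, y1) = c *\<^sub>R u" "(x3, y3) - (x1, y1) = d *\<^sub>R u"
    using u[OF assms(3,2)] u[OF assms(4,2)] by blast
  then have "x2 - x1 = c * fst u" "y2 - y1 = c * snd u" "x3 - x1 = d * fst u" "y3 - y1 = d * snd u"
    by (auto simp: prod_eq_iff)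
  then show ?thesis by simp
qed

lemma not_collinear_Un_closed_segments:
  fixes x1 y1 x2 y2 x3 y3 x4 y4 :: real
  assumes "(x2 - x1) * (y3 - y1) \<noteq> (y2 - y1) * (x3 - x1) \<or>
    (x2 - x1) * (y4 - y1) \<noteq> (y2 - y1) * (x4 - x1)"
  shows "\<not> collinear (closed_segment (x1, y1) (x2, y2) \<union> closed_segment (x3, y3) (x4, y4))"
proof
  assume c: "collinear (closed_segment (x1, y1) (x2, y2) \<union> closed_segment (x3, y3) (x4, y4))"
  show False
    using assms collinear_imp_cross_eq_0[OF c, of x1 y1 x2 y2 x3 y3]
      collinear_imp_cross_eq_0[OF c, of x1 y1 x2 y2 x4 y4] by simp
qed

lemma fst_mem_closed_segment: "p \<in> closed_segment a b \<Longrightarrow> fst p \<in> closed_segment (fst a) (fst b)"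
  by (auto simp: closed_segment_def)

lemma snd_mem_closed_segment: "p \<in> closed_segment a b \<Longrightarrow> snd p \<in> closed_segment (snd a) (snd b)"
  by (auto simp: closed_segment_def)

section \<open>The lower bound\<close>

text \<open>The slope is expressed through differences of points, so neither a line equation nor a
  base point has to be carried along.\<close>

definition slanted :: "(real \<times> real) set \<Rightarrow> bool" where
  "slanted L \<longleftrightarrow> (\<exists>s::real. s \<noteq> 0 \<and> (\<forall>p\<in>L. \<forall>q\<in>L. snd p - snd q = s * (fst p - fst q)))"

lemma slanted_closed_segment:
  fixes a b :: "real \<times> real"
  assumes "fst a \<noteq> fst b" "snd a \<noteq> snd b"
  shows "slanted (closed_segment a b)"
  unfolding slanted_def
proof (intro exI conjI ballI)
  let ?s = "(snd b - snd a) / (fst b - fst a)"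
  show "?s \<noteq> 0" using assms by auto
  fix p q assume "p \<in> closed_segment a b" "q \<in> closed_segment a b"
  then obtain u v where uv: "p = (1 - u) *\<^sub>R a + u *\<^sub>R b" "q = (1 - v) *\<^sub>R a + v *\<^sub>R b"
    by (auto simp: closed_segment_def)
  have d: "snd p - snd q = (u - v) * (snd b - snd a)" "fst p - fst q = (u - v) * (fst b - fst a)"
    unfolding uv fst_add snd_add fst_scaleR snd_scaleR real_scaleR_def by algebra+
  show "snd p - snd q = ?s * (fst p - fst q)"
    unfolding d using assms by simp
qed

lemma slanted_fst_eq_iff:
  assumes "slanted L" "p \<in> L" "q \<in> L"
  shows "fst p = fst q \<longleftrightarrow> p = q"
proof -
  obtain s where "s \<noteq> 0" "snd p - snd q = s * (fst p - fst q)"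
    using assms unfolding slanted_def by blast
  then show ?thesis by (auto simp: prod_eq_iff)
qed

lemma slanted_snd_eq_iff:
  assumes "slanted L" "p \<in> L" "q \<in> L"
  shows "snd p = snd q \<longleftrightarrow> p = q"
proof -
  obtain s where "s \<noteq> 0" "snd p - snd q = s * (fst p - fst q)"
    using assms unfolding slanted_def by blast
  then show ?thesis by (auto simp: prod_eq_iff)
qed

text \<open>Along such a line the second coordinate is strictly monotone in the first, increasing or
  decreasing with the sign of the slope.\<close>

lemma slanted_between:
  assumes "slanted L" "p \<in> L" "q \<in> L" "r \<in> L" "fst p < fst r" "fst r < fst q"
  shows "snd p < snd r \<and> snd r < snd q \<or> snd q < snd r \<and> snd r < snd p"
proof -
  obtain s where s: "s \<noteq> 0" "snd r - snd p = s * (fst r - fst p)" "snd q - snd r = s * (fst q - fst r)"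
    using assms unfolding slanted_def by blast
  show ?thesis
  proof (cases "s > 0")
    case True
    then have "0 < s * (fst r - fst p)" "0 < s * (fst q - fst r)" using assms by simp_all
    then show ?thesis using s by linarith
  next
    case False
    then have "s * (fst r - fst p) < 0" "s * (fst q - fst r) < 0"
      using assms s(1) by (simp_all add: mult_less_0_iff)
    then show ?thesis using s by linarith
  qed
qed

section \<open>Counting on the boundary of a product set\<close>

text \<open>\<open>B\<close> holds columns and \<open>A\<close> rows. They need not be consecutive,
  so the boundary is read off from their extreme elements.\<close>

definition box_boundary :: "real set \<Rightarrow> real set \<Rightarrow> (real \<times> real) set" where
  "box_boundary B A = {(x, y) \<in> B \<times> A. x = Min B \<or> x = Max B \<or> y = Min A \<or> y = Max A}"

text \<open>The \<open>4\<close> accounts for the corners, shared by extreme rows and columns; it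
  stands on the right to avoid truncated subtraction.\<close>

lemma card_box_boundary:
  assumes "finite A" "finite B" "2 \<le> card A" "2 \<le> card B"
  shows "2 * card A + 2 * card B \<le> card (box_boundary B A) + 4"
proof -
  have ends: "Min C \<in> C \<and> Max C \<in> C \<and> Min C \<noteq> Max C" if "finite C" "2 \<le> card C" for C :: "real set"
  proof -
    have ne: "C \<noteq> {}" using that by auto
    have "Min C \<noteq> Max C"
    proof
      assume eq: "Min C = Max C"
      have "x = Max C" if "x \<in> C" for x
        using Min_le[OF \<open>finite C\<close> that] Max_ge[OF \<open>finite C\<close> that] eq by linarith
      then have "C \<subseteq> {Max C}" by blast
      then have "card C \<le> card {Max C}" by (intro card_mono) auto
      with that show False by simp
    qed
    with ne that show ?thesis by simp
  qed
  \<comment> \<open>\<open>P\<close> takes the two extreme columns in full, \<open>Q\<close> the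
    extreme rows without those columns, so no corner is counted twice.\<close>
  define P where "P = {Min B, Max B} \<times> A"
  define Q where "Q = (B - {Min B, Max B}) \<times> {Min A, Max A}"
  have "card P = 2 * card A" using ends[of B] assms by (simp add: P_def card_cartesian_product)
  moreover have "card Q = 2 * (card B - 2)"
  proof -
    have "card (B - {Min B, Max B}) = card B - 2"
      using ends[of B] assms by (subst card_Diff_subset) auto
    then show ?thesis using ends[of A] assms by (simp add: Q_def card_cartesian_product)
  qed
  moreover have "card (P \<union> Q) = card P + card Q"
    using assms by (intro card_Un_disjoint) (auto simp: P_def Q_def)
  moreover have "card (P \<union> Q) \<le> card (box_boundary B A)"
  proof (rule card_mono)
    show "finite (box_boundary B A)"
      by (rule finite_subset[of _ "B \<times> A"]) (use assms in \<open>auto simp: box_boundary_def\<close>)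
    show "P \<union> Q \<subseteq> box_boundary B A"
      using ends[of A] ends[of B] assms by (auto simp: P_def Q_def box_boundary_def)
  qed
  ultimately show ?thesis using assms by linarith
qed

text \<open>A third point would lie strictly between the other two in both coordinates, hence off the boundary.\<close>

lemma card_box_boundary_Int_slanted:
  assumes "finite A" "finite B" "slanted L"
  shows "card (box_boundary B A \<inter> L) \<le> 2"
proof (cases "box_boundary B A \<inter> L = {}")
  case False
  let ?T = "box_boundary B A \<inter> L"
  have fin: "finite ?T"
    by (rule finite_subset[of _ "B \<times> A"]) (use assms in \<open>auto simp: box_boundary_def\<close>)
  obtain p where p: "Min (fst ` ?T) = fst p" "p \<in> ?T"
    by (rule imageE[OF Min_in[of "fst ` ?T"]]) (use fin False in auto)
  obtain q where q: "Max (fst ` ?T) = fst q" "q \<in> ?T"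
    by (rule imageE[OF Max_in[of "fst ` ?T"]]) (use fin False in auto)
  have "?T \<subseteq> {p, q}"
  proof
    fix r assume r: "r \<in> ?T"
    show "r \<in> {p, q}"
    proof (rule ccontr)
      assume "r \<notin> {p, q}"
      moreover have "fst p \<le> fst r" "fst r \<le> fst q"
        unfolding p(1)[symmetric] q(1)[symmetric] using fin r by (auto intro!: Min_le Max_ge)
      ultimately have lt: "fst p < fst r" "fst r < fst q"
        using slanted_fst_eq_iff[OF assms(3), of p r] slanted_fst_eq_iff[OF assms(3), of r q] p(2) q(2) r
        by auto
      with slanted_between[OF assms(3), of p q r] p(2) q(2) r
      have "snd p < snd r \<and> snd r < snd q \<or> snd q < snd r \<and> snd r < snd p" by blast
      moreover have "fst p \<in> B" "fst q \<in> B" "snd p \<in> A" "snd q \<in> A"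
        using p(2) q(2) by (auto simp: box_boundary_def)
      then have "Min B \<le> fst p" "fst q \<le> Max B" "Min A \<le> snd p" "Min A \<le> snd q"
        "snd p \<le> Max A" "snd q \<le> Max A"
        using assms by auto
      moreover have "fst r = Min B \<or> fst r = Max B \<or> snd r = Min A \<or> snd r = Max A"
        using r by (auto simp: box_boundary_def)
      ultimately show False using lt by linarith
    qed
  qed
  then have "card ?T \<le> card {p, q}" by (intro card_mono) auto
  also have "\<dots> \<le> 2" by (simp add: card_insert_if)
  finally show ?thesis .
qed simp

text \<open>A union bound. For infinite \<open>X\<close> the claim is trivial, since
  \<open>card X\<close> is then 0.\<close>

lemma card_le_mult_cover:
  assumes "finite I" "X \<subseteq> (\<Union>i\<in>I. L i)" "\<And>i. i \<in> I \<Longrightarrow> card (X \<inter> L i) \<le> c"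
  shows "card X \<le> c * card I"
proof (cases "finite X")
  case True
  have "card X = card (\<Union>i\<in>I. X \<inter> L i)"
    using assms(2) by (intro arg_cong[where f = card]) auto
  also have "\<dots> \<le> (\<Sum>i\<in>I. card (X \<inter> L i))" by (rule card_UN_le[OF assms(1)])
  also have "\<dots> \<le> c * card I" using sum_bounded_above[of I "\<lambda>i. card (X \<inter> L i)" c] assms(3) by (simp add: mult.commute)
  finally show ?thesis .
qed simp

text \<open>\<open>H\<close> and its shift by one are disjoint, and both lie among the numbers from
  0 to \<open>k\<close>.\<close>

lemma card_no_two_consecutive:
  assumes "H \<subseteq> {..<k}" "\<And>i. i \<in> H \<Longrightarrow> Suc i \<notin> H"
  shows "2 * card H \<le> k + 1"
proof -
  have fin: "finite H" using assms(1) finite_subset by blast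
  have "card H + card (Suc ` H) = card (H \<union> Suc ` H)"
    using assms(2) fin by (intro card_Un_disjoint[symmetric]) auto
  also have "\<dots> \<le> card {..<k + 1}" using assms(1) by (intro card_mono) auto
  finally show ?thesis by (simp add: card_image)
qed

section \<open>The number of edges of a covering trail\<close>

lemma length_edges [simp]: "length (edges ps) = length ps - 1"
  by (simp add: edges_def)

lemma edges_nth [simp]: "i < length ps - 1 \<Longrightarrow> edges ps ! i = closed_segment (ps ! i) (ps ! Suc i)"
  by (simp add: edges_def)

lemma covering_trail_lower_bound:
  assumes "covering_trail n ps"
  shows "2 * n \<le> link_length ps + 2"
proof -
  define k where "k = length ps - 1"
  have chain: "ps ! i \<noteq> ps ! Suc i" if "i < k" for i
    using assms that by (auto simp: covering_trail_def polygonal_chain_def k_def)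
  have cover: "\<exists>i<k. p \<in> closed_segment (ps ! i) (ps ! Suc i)" if "p \<in> grid n" for p
  proof -
    have "p \<in> \<Union> (set (edges ps))" using assms that by (auto simp: covering_trail_def)
    then show ?thesis by (auto simp: k_def edges_def)
  qed
  have noncoll: "\<not> collinear (closed_segment (ps ! i) (ps ! Suc i) \<union> closed_segment (ps ! Suc i) (ps ! Suc (Suc i)))"
    if "Suc i < k" for i
  proof -
    have "\<not> collinear (edges ps ! i \<union> edges ps ! Suc i)"
      using assms that by (simp add: covering_trail_def k_def)
    then show ?thesis using that by (simp add: k_def)
  qed
  \<comment> \<open>Indices of the horizontal, vertical and slanted edges. No edge is degenerate, so
    they partition the \<open>k\<close> indices.\<close>
  define H where "H = {i. i < k \<and> snd (ps ! i) = snd (ps ! Suc i)}"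
  define V where "V = {i. i < k \<and> fst (ps ! i) = fst (ps ! Suc i)}"
  define S where "S = {..<k} - H - V"
  have fin: "finite H" "finite V" "finite S" by (auto simp: H_def V_def S_def)
  have kcard: "k = card H + card V + card S"
  proof -
    have "H \<inter> V = {}" using chain by (auto simp: H_def V_def prod_eq_iff)
    then have "card (H \<union> V) = card H + card V" using fin by (intro card_Un_disjoint) auto
    moreover have "card ((H \<union> V) \<union> S) = card (H \<union> V) + card S"
      using fin by (intro card_Un_disjoint) (auto simp: S_def)
    moreover have "(H \<union> V) \<union> S = {..<k}" by (auto simp: H_def V_def S_def)
    ultimately show ?thesis by simp
  qed
  have H2: "2 * card H \<le> k + 1"
  proof (rule card_no_two_consecutive)
    fix i assume i: "i \<in> H"
    show "Suc i \<notin> H"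
    proof
      assume "Suc i \<in> H"
      with i have "snd p = snd (ps ! i)" if
        "p \<in> closed_segment (ps ! i) (ps ! Suc i) \<union> closed_segment (ps ! Suc i) (ps ! Suc (Suc i))" for p
        using that snd_mem_closed_segment[of p "ps ! i" "ps ! Suc i"]
          snd_mem_closed_segment[of p "ps ! Suc i" "ps ! Suc (Suc i)"] by (auto simp: H_def)
      then have "collinear (closed_segment (ps ! i) (ps ! Suc i) \<union> closed_segment (ps ! Suc i) (ps ! Suc (Suc i)))"
        by (rule collinear_snd_const)
      then show False using noncoll[of i] \<open>Suc i \<in> H\<close> by (simp add: H_def)
    qed
  qed (auto simp: H_def)
  have V2: "2 * card V \<le> k + 1"
  proof (rule card_no_two_consecutive)
    fix i assume i: "i \<in> V"
    show "Suc i \<notin> V"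
    proof
      assume "Suc i \<in> V"
      with i have "fst p = fst (ps ! i)" if
        "p \<in> closed_segment (ps ! i) (ps ! Suc i) \<union> closed_segment (ps ! Suc i) (ps ! Suc (Suc i))" for p
        using that fst_mem_closed_segment[of p "ps ! i" "ps ! Suc i"]
          fst_mem_closed_segment[of p "ps ! Suc i" "ps ! Suc (Suc i)"] by (auto simp: V_def)
      then have "collinear (closed_segment (ps ! i) (ps ! Suc i) \<union> closed_segment (ps ! Suc i) (ps ! Suc (Suc i)))"
        by (rule collinear_fst_const)
      then show False using noncoll[of i] \<open>Suc i \<in> V\<close> by (simp add: V_def)
    qed
  qed (auto simp: V_def)
  define A where "A = real ` {..<n} - (\<lambda>i. snd (ps ! i)) ` H"
  define B where "B = real ` {..<n} - (\<lambda>i. fst (ps ! i)) ` V"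
  have finAB: "finite A" "finite B" by (auto simp: A_def B_def)
  \<comment> \<open>Only an inequality: several horizontal edges may share a row, and some may lie
    on no grid row.\<close>
  have cardA: "n \<le> card A + card H"
  proof -
    have "card (real ` {..<n}) - card ((\<lambda>i. snd (ps ! i)) ` H) \<le> card A"
      unfolding A_def using fin by (intro diff_card_le_card_Diff) auto
    moreover have "card ((\<lambda>i. snd (ps ! i)) ` H) \<le> card H" using fin by (intro card_image_le)
    moreover have "card (real ` {..<n}) = n" by (simp add: card_image)
    ultimately show ?thesis by linarith
  qed
  have cardB: "n \<le> card B + card V"
  proof -
    have "card (real ` {..<n}) - card ((\<lambda>i. fst (ps ! i)) ` V) \<le> card B"
      unfolding B_def using fin by (intro diff_card_le_card_Diff) auto
    moreover have "card ((\<lambda>i. fst (ps ! i)) ` V) \<le> card V" using fin by (intro card_image_le)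
    moreover have "card (real ` {..<n}) = n" by (simp add: card_image)
    ultimately show ?thesis by linarith
  qed
  let ?L = "\<lambda>i. closed_segment (ps ! i) (ps ! Suc i)"
  have slanted: "slanted (?L i)" if "i \<in> S" for i
    using that by (intro slanted_closed_segment) (auto simp: S_def H_def V_def)
  have sub: "B \<times> A \<subseteq> (\<Union>i\<in>S. ?L i)"
  proof
    fix p assume p: "p \<in> B \<times> A"
    then have "p \<in> grid n" by (auto simp: A_def B_def grid_def)
    then obtain i where i: "i < k" "p \<in> ?L i" using cover by blast
    have "i \<notin> H"
    proof
      assume "i \<in> H"
      then have "snd p = snd (ps ! i)"
        using snd_mem_closed_segment[OF i(2)] by (simp add: H_def)
      with \<open>i \<in> H\<close> p show False by (auto simp: A_def)
    qed
    moreover have "i \<notin> V"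
    proof
      assume "i \<in> V"
      then have "fst p = fst (ps ! i)"
        using fst_mem_closed_segment[OF i(2)] by (simp add: V_def)
      with \<open>i \<in> V\<close> p show False by (auto simp: B_def)
    qed
    ultimately show "p \<in> (\<Union>i\<in>S. ?L i)" using i by (auto simp: S_def)
  qed
  \<comment> \<open>A row of \<open>A\<close> has \<open>card B\<close> points that only slanted
    edges can cover, at most one each. Together with \<open>SA\<close> this settles the case where
    \<open>A\<close> or \<open>B\<close> is a singleton, which \<open>bd\<close> leaves
    open.\<close>
  have SB: "card B \<le> card S" if nonempty: "A \<noteq> {}"
  proof -
    obtain y where y: "y \<in> A" using nonempty by blast
    have "card (B \<times> {y}) \<le> 1 * card S"
    proof (rule card_le_mult_cover[OF fin(3), where L = ?L])
      show "card (B \<times> {y} \<inter> ?L i) \<le> 1" if "i \<in> S" for i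
      proof -
        have "p = q" if "p \<in> B \<times> {y} \<inter> ?L i" "q \<in> B \<times> {y} \<inter> ?L i" for p q
          using slanted_snd_eq_iff[OF slanted[OF \<open>i \<in> S\<close>], of p q] that by auto
        moreover have "finite (B \<times> {y} \<inter> ?L i)" using finAB by simp
        ultimately show ?thesis by (simp only: One_nat_def card_le_Suc0_iff_eq) blast
      qed
    qed (use sub y in auto)
    then show ?thesis by (simp add: card_cartesian_product)
  qed
  have SA: "card A \<le> card S" if nonempty: "B \<noteq> {}"
  proof -
    obtain x where x: "x \<in> B" using nonempty by blast
    have "card ({x} \<times> A) \<le> 1 * card S"
    proof (rule card_le_mult_cover[OF fin(3), where L = ?L])
      show "card ({x} \<times> A \<inter> ?L i) \<le> 1" if "i \<in> S" for i
      proof -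
        have "p = q" if "p \<in> {x} \<times> A \<inter> ?L i" "q \<in> {x} \<times> A \<inter> ?L i" for p q
          using slanted_fst_eq_iff[OF slanted[OF \<open>i \<in> S\<close>], of p q] that by auto
        moreover have "finite ({x} \<times> A \<inter> ?L i)" using finAB by simp
        ultimately show ?thesis by (simp only: One_nat_def card_le_Suc0_iff_eq) blast
      qed
    qed (use sub x in auto)
    then show ?thesis by (simp add: card_cartesian_product)
  qed
  have bd: "2 * card A + 2 * card B \<le> 2 * card S + 4" if "2 \<le> card A" "2 \<le> card B"
  proof -
    have "card (box_boundary B A) \<le> 2 * card S"
    proof (rule card_le_mult_cover[OF fin(3), where L = ?L])
      show "box_boundary B A \<subseteq> (\<Union>i\<in>S. ?L i)"
        using sub by (auto simp: box_boundary_def)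
    qed (use card_box_boundary_Int_slanted finAB slanted in blast)
    with card_box_boundary[OF finAB that] show ?thesis by linarith
  qed
  have "2 * n \<le> k + 2"
  proof (cases "card A = 0 \<or> card B = 0")
    case True
    \<comment> \<open>Here \<open>n \<le> card H\<close> or \<open>n \<le> card V\<close>, so that
      even \<open>2 * n \<le> k + 1\<close>.\<close>
    then show ?thesis using H2 V2 cardA cardB by linarith
  next
    case False
    then have "A \<noteq> {}" "B \<noteq> {}" by auto
    then have "card A \<le> card S" "card B \<le> card S" using SA SB by auto
    \<comment> \<open>If both sets have two elements, \<open>bd\<close> gives at least |A| + |B| - 2
      slanted edges; if one is a singleton, the bound by the other set gives |A| + |B| - 1.\<close>
    with False show ?thesis
      using bd cardA cardB kcard by (cases "2 \<le> card A \<and> 2 \<le> card B") auto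
  qed
  then show ?thesis by (simp add: link_length_def k_def)
qed

section \<open>Two edges do not cover the unit square\<close>

text \<open>No segment contains three corners, so each would contain exactly two. Opposite sides lie
  on parallel lines and cannot share the endpoint \<open>q\<close>; with the two diagonals
  \<open>q\<close> would be the centre, which is not an endpoint of a segment containing a whole
  diagonal.\<close>

lemma unit_square_not_covered_by_two_segments:
  fixes p q r :: "real \<times> real"
  shows "\<not> {(0, 0), (0, 1), (1, 0), (1, 1)} \<subseteq> closed_segment q p \<union> closed_segment q r"
proof -
  \<comment> \<open>What each pair of corners on a segment from \<open>q\<close> forces on
    \<open>q\<close>. The inequality for the diagonal says that the endpoint \<open>q\<close> is not
    strictly between the two corners.\<close>
  have *: "((0, 0) \<in> closed_segment q z \<and> (1, 0) \<in> closed_segment q z \<longrightarrow> snd q = 0 \<and> snd z = 0) \<and>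
    ((0, 1) \<in> closed_segment q z \<and> (1, 1) \<in> closed_segment q z \<longrightarrow> snd q = 1 \<and> snd z = 1) \<and>
    ((0, 0) \<in> closed_segment q z \<and> (0, 1) \<in> closed_segment q z \<longrightarrow> fst q = 0 \<and> fst z = 0) \<and>
    ((1, 0) \<in> closed_segment q z \<and> (1, 1) \<in> closed_segment q z \<longrightarrow> fst q = 1 \<and> fst z = 1) \<and>
    ((0, 0) \<in> closed_segment q z \<and> (1, 1) \<in> closed_segment q z \<longrightarrow>
      fst q = snd q \<and> (fst q \<le> 0 \<or> 1 \<le> fst q)) \<and>
    ((0, 1) \<in> closed_segment q z \<and> (1, 0) \<in> closed_segment q z \<longrightarrow> fst q + snd q = 1)"
    for z :: "real \<times> real"
  proof -
    obtain a b c d where qz: "q = (a, b)" "z = (c, d)" by (metis surj_pair)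
    have diag: "a = b" if "(0, 0) \<in> closed_segment q z" "(1, 1) \<in> closed_segment q z"
    proof -
      have "c \<noteq> a" using that[THEN fst_mem_closed_segment] by (auto simp: qz)
      moreover have "(c - a) * (0 - b) = (d - b) * (0 - a)" "(c - a) * (1 - b) = (d - b) * (1 - a)"
        using that unfolding qz mem_closed_segment_prod_iff by blast+
      then have "(c - a) * (a - b) = 0" by algebra
      ultimately show ?thesis by simp
    qed
    have antidiag: "a + b = 1" if "(0, 1) \<in> closed_segment q z" "(1, 0) \<in> closed_segment q z"
    proof -
      have "c \<noteq> a" using that[THEN fst_mem_closed_segment] by (auto simp: qz)
      moreover have "(c - a) * (1 - b) = (d - b) * (0 - a)" "(c - a) * (0 - b) = (d - b) * (1 - a)"
        using that unfolding qz mem_closed_segment_prod_iff by blast+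
      then have "(c - a) * (a + b - 1) = 0" by algebra
      ultimately show ?thesis by simp
    qed
    \<comment> \<open>Both corners have coordinate \<open>t\<close> in one direction and 0 or 1 in
      the other; subtracting the two line equations leaves \<open>v - u = 0\<close>.\<close>
    have eq: "u = t \<and> v = t"
      if "t \<in> closed_segment u v" "(w - s) * (t - u) = (v - u) * (0 - s)" "(w - s) * (t - u) = (v - u) * (1 - s)"
      for s t u v w :: real
    proof -
      have "v - u = 0" using that(2,3) by algebra
      with that(1) show ?thesis by simp
    qed
    have eq': "u = t \<and> v = t"
      if "t \<in> closed_segment u v" "(v - u) * (0 - s) = (w - s) * (t - u)" "(v - u) * (1 - s) = (w - s) * (t - u)"
      for s t u v w :: real
      using eq[OF that(1) that(2,3)[symmetric]] .
    show ?thesis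
      unfolding qz fst_conv snd_conv
    proof (intro conjI impI)
      show "b = 0" "d = 0" if "(0, 0) \<in> closed_segment (a, b) (c, d) \<and> (1, 0) \<in> closed_segment (a, b) (c, d)"
        using that eq[of 0 b d c a] unfolding mem_closed_segment_prod_iff by blast+
      show "b = 1" "d = 1" if "(0, 1) \<in> closed_segment (a, b) (c, d) \<and> (1, 1) \<in> closed_segment (a, b) (c, d)"
        using that eq[of 1 b d c a] unfolding mem_closed_segment_prod_iff by blast+
      show "a = 0" "c = 0" if "(0, 0) \<in> closed_segment (a, b) (c, d) \<and> (0, 1) \<in> closed_segment (a, b) (c, d)"
        using that eq'[of 0 a c b d] unfolding mem_closed_segment_prod_iff by blast+
      show "a = 1" "c = 1" if "(1, 0) \<in> closed_segment (a, b) (c, d) \<and> (1, 1) \<in> closed_segment (a, b) (c, d)"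
        using that eq'[of 1 a c b d] unfolding mem_closed_segment_prod_iff by blast+
      show "a = b" if "(0, 0) \<in> closed_segment (a, b) (c, d) \<and> (1, 1) \<in> closed_segment (a, b) (c, d)"
        using that diag unfolding qz by blast
      show "a \<le> 0 \<or> 1 \<le> a" if "(0, 0) \<in> closed_segment (a, b) (c, d) \<and> (1, 1) \<in> closed_segment (a, b) (c, d)"
        using that fst_mem_closed_segment[of "(0, 0)" "(a, b)" "(c, d)"]
          fst_mem_closed_segment[of "(1, 1)" "(a, b)" "(c, d)"]
        by (auto simp: closed_segment_eq_real_ivl split: if_splits)
      show "a + b = 1" if "(0, 1) \<in> closed_segment (a, b) (c, d) \<and> (1, 0) \<in> closed_segment (a, b) (c, d)"
        using that antidiag unfolding qz by blast
    qed
  qed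
  let ?A = "\<lambda>z. (0, 0) \<in> closed_segment q z" and ?B = "\<lambda>z. (0, 1) \<in> closed_segment q z"
  let ?C = "\<lambda>z. (1, 0) \<in> closed_segment q z" and ?D = "\<lambda>z. (1, 1) \<in> closed_segment q z"
  have AC: "snd q = 0 \<and> snd z = 0" if "?A z" "?C z" for z using *[of z] that by blast
  have BD: "snd q = 1" if "?B z" "?D z" for z using *[of z] that by blast
  have AB: "fst q = 0" if "?A z" "?B z" for z using *[of z] that by blast
  have CD: "fst q = 1" if "?C z" "?D z" for z using *[of z] that by blast
  have AD: "fst q = snd q" "fst q \<le> 0 \<or> 1 \<le> fst q" if "?A z" "?D z" for z using *[of z] that by blast+
  have BC: "fst q + snd q = 1" if "?B z" "?C z" for z using *[of z] that by blast
  have ABC: "\<not> (?A z \<and> ?B z \<and> ?C z)" for z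
    using AC[of z] snd_mem_closed_segment[of "(0, 1)" q z] by auto
  have ABD: "\<not> (?A z \<and> ?B z \<and> ?D z)" for z
    using AB[of z] BD[of z] AD(1)[of z] by linarith
  have ACD: "\<not> (?A z \<and> ?C z \<and> ?D z)" for z
    using AC[of z] CD[of z] AD(1)[of z] by linarith
  have BCD: "\<not> (?B z \<and> ?C z \<and> ?D z)" for z
    using BC[of z] BD[of z] CD[of z] by linarith
  \<comment> \<open>The three ways to split the corners into two pairs: horizontal sides, vertical
    sides, diagonals.\<close>
  have AC_BD: "\<not> (?A z \<and> ?C z \<and> ?B w \<and> ?D w)" for z w
    using AC[of z] BD[of w] by linarith
  have AB_CD: "\<not> (?A z \<and> ?B z \<and> ?C w \<and> ?D w)" for z w
    using AB[of z] CD[of w] by linarith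
  have AD_BC: "\<not> (?A z \<and> ?D z \<and> ?B w \<and> ?C w)" for z w
    using AD[of z] BC[of w] by linarith
  show ?thesis
  proof
    assume "{(0, 0), (0, 1), (1, 0), (1, 1)} \<subseteq> closed_segment q p \<union> closed_segment q r"
    then have "?A p \<or> ?A r" "?B p \<or> ?B r" "?C p \<or> ?C r" "?D p \<or> ?D r" by auto
    then show False
      using ABC[of p] ABC[of r] ABD[of p] ABD[of r] ACD[of p] ACD[of r] BCD[of p] BCD[of r]
        AC_BD[of p r] AC_BD[of r p] AB_CD[of p r] AB_CD[of r p] AD_BC[of p r] AD_BC[of r p]
      by argo
  qed
qed

text \<open>The general bound yields only 2 here. A chain of two edges is a pair of segments sharing
  the middle vertex.\<close>

lemma covering_trail_2_lower_bound:
  assumes "covering_trail 2 ps"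
  shows "3 \<le> link_length ps"
proof (rule ccontr)
  assume "\<not> 3 \<le> link_length ps"
  with covering_trail_lower_bound[OF assms] have "length ps = 3"
    by (simp add: link_length_def)
  then obtain p q r where ps: "ps = [p, q, r]"
    by (auto simp: numeral_3_eq_3 length_Suc_conv)
  have "{(0, 0), (0, 1), (1, 0), (1, 1)} \<subseteq> grid 2"
    unfolding grid_def by (force intro: exI[of _ "0::nat"] exI[of _ "1::nat"])
  also have "\<dots> \<subseteq> closed_segment q p \<union> closed_segment q r"
    using assms by (simp add: covering_trail_def ps edges_def closed_segment_commute upt_rec)
  finally show False using unit_square_not_covered_by_two_segments by blast
qed

section \<open>The construction\<close>

lemma edges_simps [simp]:
  "edges [] = []" "edges [p] = []" "edges (p # q # ps) = closed_segment p q # edges (q # ps)"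
  by (auto simp: edges_def upt_conv_Cons map_Suc_upt[symmetric] simp del: upt_Suc map_Suc_upt)

lemma edges_snoc: "xs \<noteq> [] \<Longrightarrow> edges (xs @ p # ps) = edges xs @ edges (last xs # p # ps)"
proof (induction xs)
  case (Cons x xs)
  then show ?case by (cases xs) auto
qed simp

lemma edges_Cons: "xs \<noteq> [] \<Longrightarrow> edges (p # xs) = closed_segment p (hd xs) # edges xs"
  by (cases xs) auto

section \<open>Spiral circuits and their extension by one turn\<close>

abbreviation noncollinear :: "(real \<times> real) set \<Rightarrow> (real \<times> real) set \<Rightarrow> bool" where
  "noncollinear e f \<equiv> \<not> collinear (e \<union> f)"

text \<open>\<open>m\<close> lists the intermediate vertices, so there are
  \<open>length m + 1\<close> edges; the equation \<open>length m + 3 = 2 * n\<close> in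
  \<open>spiral\<close> thus asks for 2(n - 1) edges.\<close>

definition corner_circuit :: "real \<Rightarrow> (real \<times> real) list \<Rightarrow> (real \<times> real) list" where
  "corner_circuit b m = (b, b) # m @ [(b, b)]"

text \<open>
  That every edge meets the square keeps it off the lines of the edges added by the next turn.
\<close>

definition spiral :: "real \<Rightarrow> nat \<Rightarrow> (real \<times> real) list \<Rightarrow> bool" where
  "spiral a n m \<longleftrightarrow> (let b = a + real n - 1; E = edges (corner_circuit b m) in
     length m + 3 = 2 * n \<and> m \<noteq> [] \<and> successively (\<noteq>) m \<and>
     (\<exists>s<b. hd m = (s, s)) \<and> (\<exists>y<b. last m = (b, y)) \<and>
     sorted_wrt noncollinear E \<and>
     (\<forall>e\<in>set E. e \<inter> {a..b} \<times> {a..b} \<noteq> {}) \<and>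
     (\<forall>i<n. \<forall>j<n. (a + real i, a + real j) \<in> \<Union> (set E)))"

lemma edges_corner_circuit:
  "m \<noteq> [] \<Longrightarrow> edges (corner_circuit b m) =
    closed_segment (b, b) (hd m) # edges m @ [closed_segment (last m) (b, b)]"
  by (simp add: corner_circuit_def edges_Cons edges_snoc)

text \<open>One point of \<open>e\<close> off the vertical line is enough; for old edges it is
  supplied by the square that they meet.\<close>

lemma noncollinear_vertical:
  fixes x y1 y2 :: real
  assumes "p \<in> e" "fst p \<noteq> x" "y1 \<noteq> y2"
  shows "noncollinear e (closed_segment (x, y1) (x, y2))"
proof
  assume "collinear (e \<union> closed_segment (x, y1) (x, y2))"
  from collinear_imp_cross_eq_0[OF this, of x y1 x y2 "fst p" "snd p"] assms show False by auto
qed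

lemma noncollinear_horizontal:
  fixes y x1 x2 :: real
  assumes "p \<in> e" "snd p \<noteq> y" "x1 \<noteq> x2"
  shows "noncollinear e (closed_segment (x1, y) (x2, y))"
proof
  assume "collinear (e \<union> closed_segment (x1, y) (x2, y))"
  from collinear_imp_cross_eq_0[OF this, of x1 y x2 y "fst p" "snd p"] assms show False by auto
qed

lemma noncollinear_mono:
  "noncollinear e f \<Longrightarrow> e \<subseteq> e' \<Longrightarrow> f \<subseteq> f' \<Longrightarrow> noncollinear e' f'"
  by (meson Un_mono collinear_subset)

text \<open>
  The closing corner moves from \<open>(r, r)\<close> to \<open>(r + 1, r + 1)\<close>: the first edge is prolonged along the
  diagonal, the last one upwards, and one turn around the old square is inserted.
\<close>

lemma spiral_step:
  assumes "spiral (a + 1) n m"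
  defines "r \<equiv> a + real n"
  shows "spiral a (n + 2) (m @ [(r, r + 1), (a, r + 1), (a, a), (r + 1, a)])"
proof -
  let ?m = "m @ [(r, r + 1), (a, r + 1), (a, a), (r + 1, a)]"
  \<comment> \<open>\<open>r\<close> and \<open>r + 1\<close> are the coordinates of the old and the
    new upper right corner.\<close>
  have r: "a + 1 + real n - 1 = r" "a + real (n + 2) - 1 = r + 1" by (simp_all add: r_def)
  obtain s y where m: "length m + 3 = 2 * n" "m \<noteq> []" "successively (\<noteq>) m"
    and s: "s < r" "hd m = (s, s)" and y: "y < r" "last m = (r, y)"
    using assms(1) unfolding spiral_def Let_def r by blast
  have n: "n \<ge> 2" using m by (cases m) auto
  then have ar: "a + 2 \<le> r" by (simp add: r_def)
  define f where "f = closed_segment (r, r) (s, s)"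
  define f' where "f' = closed_segment (r + 1, r + 1) (s, s)"
  define l where "l = closed_segment (r, y) (r, r)"
  define l' where "l' = closed_segment (r, y) (r, r + 1)"
  \<comment> \<open>The new turn: top, left, bottom and right side of the new square, where the top
    side starts only at column \<open>r\<close>.\<close>
  define N where "N = [closed_segment (r, r + 1) (a, r + 1), closed_segment (a, r + 1) (a, a),
    closed_segment (a, a) (r + 1, a), closed_segment (r + 1, a) (r + 1, r + 1)]"
  have E: "edges (corner_circuit r m) = f # edges m @ [l]"
    using m s y by (simp add: edges_corner_circuit f_def l_def)
  have E': "edges (corner_circuit (r + 1) ?m) = f' # edges m @ [l'] @ N"
    using m s y by (simp add: edges_corner_circuit edges_snoc f'_def l'_def N_def)
  have old: "sorted_wrt noncollinear (f # edges m @ [l])"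
    "\<And>e. e \<in> set (f # edges m @ [l]) \<Longrightarrow> e \<inter> {a + 1..r} \<times> {a + 1..r} \<noteq> {}"
    "\<And>i j. i < n \<Longrightarrow> j < n \<Longrightarrow> (a + 1 + real i, a + 1 + real j) \<in> \<Union> (set (f # edges m @ [l]))"
    using assms(1) unfolding spiral_def Let_def r E by blast+
  have ff': "f \<subseteq> f'"
    using s unfolding f_def f'_def subset_closed_segment
    by (simp add: mem_closed_segment_prod_iff closed_segment_eq_real_ivl)
  have ll': "l \<subseteq> l'"
    using y unfolding l_def l'_def subset_closed_segment
    by (simp add: mem_closed_segment_prod_iff closed_segment_eq_real_ivl)
  have inner: "e \<inter> {a + 1..r} \<times> {a + 1..r} \<noteq> {}" if "e \<in> set (f' # edges m @ [l'])" for e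
    using that old(2)[of f] old(2)[of l] old(2)[of e] ff' ll' by auto
  \<comment> \<open>A point with both coordinates between \<open>a + 1\<close> and \<open>r\<close>
    is off all four side lines of the new square.\<close>
  have oldN: "noncollinear e g" if e: "e \<in> set (f' # edges m @ [l'])" and g: "g \<in> set N" for e g
  proof -
    obtain p where p: "p \<in> e" "a + 1 \<le> fst p" "fst p \<le> r" "a + 1 \<le> snd p" "snd p \<le> r"
      using inner[OF e] by force
    show ?thesis using g p ar
      by (auto simp: N_def noncollinear_vertical[OF p(1)] noncollinear_horizontal[OF p(1)])
  qed
  have NN: "sorted_wrt noncollinear N"
    using ar by (simp add: N_def not_collinear_Un_closed_segments)
  have "sorted_wrt noncollinear (f' # edges m @ [l'])"
    using old(1) noncollinear_mono[OF _ ff' subset_refl] noncollinear_mono[OF _ subset_refl ll']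
    unfolding sorted_wrt.simps sorted_wrt_append list.set set_append by blast
  then have "sorted_wrt noncollinear ((f' # edges m @ [l']) @ N)"
    using NN oldN by (subst sorted_wrt_append) blast
  then have 1: "sorted_wrt noncollinear (f' # edges m @ [l'] @ N)" by simp
  have 2: "e \<inter> {a..r + 1} \<times> {a..r + 1} \<noteq> {}" if "e \<in> set (f' # edges m @ [l'] @ N)" for e
  proof (cases "e \<in> set N")
    case True
    then have "(r, r + 1) \<in> e \<or> (a, a) \<in> e \<or> (r + 1, a) \<in> e" by (auto simp: N_def)
    then show ?thesis using ar by auto
  next
    case False
    then have "e \<inter> {a + 1..r} \<times> {a + 1..r} \<noteq> {}" using that by (intro inner) auto
    then show ?thesis by force
  qed
  have 3: "(a + real i, a + real j) \<in> \<Union> (set (f' # edges m @ [l'] @ N))" if ij: "i < n + 2" "j < n + 2" for i j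
  proof (cases "i \<in> {1..n} \<and> j \<in> {1..n}")
    case True
    then have "(a + 1 + real (i - 1), a + 1 + real (j - 1)) \<in> \<Union> (set (f # edges m @ [l]))"
      by (intro old(3)) auto
    then have "(a + real i, a + real j) \<in> \<Union> (set (f # edges m @ [l]))"
      using True by (simp add: of_nat_diff)
    then show ?thesis using ff' ll' by auto
  next
    case False
    have bounds: "real i \<le> real n + 1" "real j \<le> real n + 1" using ij by linarith+
    \<comment> \<open>The top edge reaches only column index \<open>n\<close>; the upper right
      corner is left to the right edge, hence \<open>i \<le> n\<close> in the last case.\<close>
    consider "i = 0" | "i = n + 1" | "j = 0" | "j = n + 1" "i \<le> n"
      using False ij unfolding atLeastAtMost_iff by linarith
    then have "(a + real i, a + real j) \<in> closed_segment (r, r + 1) (a, r + 1) \<or>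
      (a + real i, a + real j) \<in> closed_segment (a, r + 1) (a, a) \<or>
      (a + real i, a + real j) \<in> closed_segment (a, a) (r + 1, a) \<or>
      (a + real i, a + real j) \<in> closed_segment (r + 1, a) (r + 1, r + 1)"
    proof cases
      case 1
      with bounds have "(a + real i, a + real j) \<in> closed_segment (a, r + 1) (a, a)"
        by (simp add: mem_closed_segment_prod_iff closed_segment_eq_real_ivl r_def)
      then show ?thesis by blast
    next
      case 2
      then have "a + real i = r + 1" by (simp add: r_def)
      with bounds have "(a + real i, a + real j) \<in> closed_segment (r + 1, a) (r + 1, r + 1)"
        by (simp add: mem_closed_segment_prod_iff closed_segment_eq_real_ivl r_def)
      then show ?thesis by blast
    next
      case 3
      with bounds have "(a + real i, a + real j) \<in> closed_segment (a, a) (r + 1, a)"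
        by (simp add: mem_closed_segment_prod_iff closed_segment_eq_real_ivl r_def)
      then show ?thesis by blast
    next
      case 4
      then have "a + real j = r + 1" by (simp add: r_def)
      with bounds 4 have "(a + real i, a + real j) \<in> closed_segment (r, r + 1) (a, r + 1)"
        by (simp add: mem_closed_segment_prod_iff closed_segment_eq_real_ivl r_def)
      then show ?thesis by blast
    qed
    then have "(a + real i, a + real j) \<in> \<Union> (set N)" by (simp add: N_def)
    then show ?thesis by auto
  qed
  show ?thesis
    unfolding spiral_def Let_def r E'
  proof (intro conjI ballI allI impI)
    show "successively (\<noteq>) ?m"
      using m y ar by (simp add: successively_append_iff)
    show "\<exists>t<r + 1. hd ?m = (t, t)" using m s by (intro exI[of _ s]) simp
    show "\<exists>y<r + 1. last ?m = (r + 1, y)" using ar by (intro exI[of _ a]) simp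
  qed (use m 1 2 3 in \<open>blast | simp\<close>)+
qed

section \<open>Base circuits and existence of spirals\<close>

text \<open>For an explicit circuit, one witness point per edge, listed in the order of the edges,
  shows that all edges meet the square.\<close>

lemma list_all2_mem_imp_Int_nonempty:
  assumes "list_all2 (\<in>) ps E" "set ps \<subseteq> X" "e \<in> set E"
  shows "e \<inter> X \<noteq> {}"
proof -
  obtain i where "i < length E" "e = E ! i" using assms(3) by (auto simp: in_set_conv_nth)
  then have "ps ! i \<in> e" "ps ! i \<in> X" using assms by (auto simp: list_all2_conv_all_nth)
  then show ?thesis by blast
qed

text \<open>Relative to \<open>(a, a)\<close>, the edges are the diagonal, a line of slope 2 through
  (0, 1) and (1, 3), column 2, a line of slope -2 through (1, 0) and (0, 2), the antidiagonal and
  column 3.\<close>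

lemma spiral_4: "spiral a 4 [(a - 1, a - 1), (a + 2, a + 5), (a + 2, a - 2), (a - 1, a + 4), (a + 3, a)]"
  (is "spiral a 4 ?m")
  unfolding spiral_def Let_def
proof (intro conjI ballI allI impI)
  fix i j :: nat
  assume "i < 4" "j < 4"
  then have "i \<in> {0, 1, 2, 3}" "j \<in> {0, 1, 2, 3}" by auto
  then show "(a + real i, a + real j) \<in> \<Union> (set (edges (corner_circuit (a + real 4 - 1) ?m)))"
    by (elim insertE emptyE; simp add: corner_circuit_def mem_closed_segment_prod_iff closed_segment_eq_real_ivl)
next
  fix e assume "e \<in> set (edges (corner_circuit (a + real 4 - 1) ?m))"
  then show "e \<inter> {a..a + real 4 - 1} \<times> {a..a + real 4 - 1} \<noteq> {}"
    by (rule list_all2_mem_imp_Int_nonempty[rotated 2, where ps =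
          "[(a, a), (a, a + 1), (a + 2, a), (a, a + 2), (a, a + 3), (a + 3, a)]"])
      (simp_all add: corner_circuit_def mem_closed_segment_prod_iff closed_segment_eq_real_ivl)
qed (auto simp: corner_circuit_def not_collinear_Un_closed_segments)

text \<open>Relative to \<open>(a, a)\<close>: the diagonal, slope 2 through (0, 1) and (1, 3),
  column 3, slope -1 from (3, 0) through (0, 3), row 4, slope 1/2 through (2, 3) and (0, 2), row 0,
  column 4. The corner (4, 4) is also an intermediate vertex.\<close>

lemma spiral_5: "spiral a 5 [(a - 1, a - 1), (a + 3, a + 7), (a + 3, a), (a - 1, a + 4), (a + 4, a + 4),
    (a - 4, a), (a + 4, a)]"
  (is "spiral a 5 ?m")
  unfolding spiral_def Let_def
proof (intro conjI ballI allI impI)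
  fix i j :: nat
  assume "i < 5" "j < 5"
  then have "i \<in> {0, 1, 2, 3, 4}" "j \<in> {0, 1, 2, 3, 4}" by auto
  then show "(a + real i, a + real j) \<in> \<Union> (set (edges (corner_circuit (a + real 5 - 1) ?m)))"
    by (elim insertE emptyE; simp add: corner_circuit_def mem_closed_segment_prod_iff closed_segment_eq_real_ivl)
next
  fix e assume "e \<in> set (edges (corner_circuit (a + real 5 - 1) ?m))"
  then show "e \<inter> {a..a + real 5 - 1} \<times> {a..a + real 5 - 1} \<noteq> {}"
    by (rule list_all2_mem_imp_Int_nonempty[rotated 2, where ps =
          "[(a, a), (a, a + 1), (a + 3, a), (a, a + 3), (a, a + 4), (a, a + 2), (a, a), (a + 4, a)]"])
      (simp_all add: corner_circuit_def mem_closed_segment_prod_iff closed_segment_eq_real_ivl)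
qed (auto simp: corner_circuit_def not_collinear_Un_closed_segments)

text \<open>One turn adds 2 to the side, so base cases of both parities are used; \<open>a\<close>
  varies because the inner square starts at \<open>a + 1\<close>.\<close>

lemma spiral_exists:
  assumes "n \<ge> 4"
  shows "\<exists>m. spiral a n m"
  using assms
proof (induction n arbitrary: a rule: less_induct)
  case (less n)
  consider "n = 4" | "n = 5" | "n \<ge> 6" using less.prems by linarith
  then show ?case
  proof cases
    case 3
    then have "\<exists>m. spiral (a + 1) (n - 2) m" and eq: "n - 2 + 2 = n" by (auto intro: less.IH)
    then obtain m where "spiral (a + 1) (n - 2) m" by blast
    from spiral_step[OF this] show ?thesis unfolding eq by blast
  qed (use spiral_4 spiral_5 in blast)+
qed

section \<open>From spirals to the minimum link length\<close>

text \<open>A segment is collinear with itself, so equal edges would contradict noncollinearity. The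
  pairwise condition thus serves both for distinctness and for consecutive edges.\<close>

lemma sorted_wrt_noncollinear_imp_distinct:
  "sorted_wrt noncollinear (edges ps) \<Longrightarrow> distinct (edges ps)"
proof -
  assume *: "sorted_wrt noncollinear (edges ps)"
  show ?thesis unfolding distinct_conv_nth
  proof (intro allI impI)
    fix i j assume ij: "i < length (edges ps)" "j < length (edges ps)" "i \<noteq> j"
    then have "noncollinear (edges ps ! i) (edges ps ! j)"
      using sorted_wrt_nth_less[OF *] by (metis Un_commute linorder_neqE_nat)
    moreover have "collinear (edges ps ! i)"
      using ij by (simp add: collinear_closed_segment)
    ultimately show "edges ps ! i \<noteq> edges ps ! j" by (metis Un_absorb)
  qed
qed

lemma covering_circuitI:
  assumes "2 \<le> length ps" "successively (\<noteq>) ps" "sorted_wrt noncollinear (edges ps)"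
    "\<And>i j. i < n \<Longrightarrow> j < n \<Longrightarrow> (real i, real j) \<in> \<Union> (set (edges ps))" "hd ps = last ps"
  shows "covering_circuit n ps"
  unfolding covering_circuit_def covering_trail_def polygonal_chain_def
proof (intro conjI allI impI)
  show "ps ! i \<noteq> ps ! Suc i" if "Suc i < length ps" for i
    using assms(2) that by (simp add: successively_conv_nth)
  show "grid n \<subseteq> \<Union> (set (edges ps))" using assms(4) by (force simp: grid_def)
  show "distinct (edges ps)" using assms(3) by (rule sorted_wrt_noncollinear_imp_distinct)
  show "noncollinear (edges ps ! i) (edges ps ! Suc i)" if "Suc i < length (edges ps)" for i
    using sorted_wrt_nth_less[OF assms(3)] that by blast
qed (use assms in auto)

lemma spiral_imp_covering_circuit:
  assumes "spiral 0 n m"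
  defines "ps \<equiv> corner_circuit (real n - 1) m"
  shows "covering_circuit n ps" "link_length ps = 2 * (n - 1)"
proof -
  have *: "length m + 3 = 2 * n" "m \<noteq> []" "successively (\<noteq>) m" "hd m \<noteq> (real n - 1, real n - 1)"
    "last m \<noteq> (real n - 1, real n - 1)"
    using assms(1) by (auto simp: spiral_def Let_def)
  then have "successively (\<noteq>) ps"
    by (auto simp: ps_def corner_circuit_def successively_append_iff successively_Cons hd_append)
  then show "covering_circuit n ps"
    using assms(1) by (intro covering_circuitI) (auto simp: spiral_def Let_def ps_def corner_circuit_def)
  show "link_length ps = 2 * (n - 1)"
    using *(1) by (simp add: link_length_def ps_def corner_circuit_def)
qed

text \<open>An isosceles right triangle: its base covers the bottom row, and its legs of slopes -1
  and 1 pass through (1, 1) and (0, 1).\<close>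

lemma covering_circuit_2: "covering_circuit 2 [(-1, 0), (2, 0), (1/2, 3/2), (-1, 0)]"
  by (rule covering_circuitI)
    (auto simp: not_collinear_Un_closed_segments less_Suc_eq numeral_2_eq_2 mem_closed_segment_prod_iff
      closed_segment_eq_real_ivl)

lemma min_link_length_eqI:
  assumes "covering_trail n ps" "\<And>qs. covering_trail n qs \<Longrightarrow> link_length ps \<le> link_length qs"
  shows "min_link_length n = link_length ps"
  unfolding min_link_length_def using assms by (intro Least_equality) auto

theorem theorem2p2:
  fixes n :: nat
  assumes "n \<ge> 2" and "n \<noteq> 3"
  shows "(\<exists>ps. covering_circuit n ps \<and> link_length ps = min_link_length n) \<and>
         min_link_length n = (if n = 2 then 3 else 2 * (n - 1))"
proof -
  obtain ps where ps: "covering_circuit n ps" "link_length ps = (if n = 2 then 3 else 2 * (n - 1))"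
  proof (cases "n = 2")
    case True
    then show ?thesis using covering_circuit_2 by (intro that) (auto simp: link_length_def)
  next
    case False
    then obtain m where "spiral 0 n m" using spiral_exists[of n 0] assms by auto
    from spiral_imp_covering_circuit[OF this] False show ?thesis by (intro that) auto
  qed
  moreover have "min_link_length n = link_length ps"
  proof (rule min_link_length_eqI)
    show "covering_trail n ps" using ps by (simp add: covering_circuit_def)
    show "link_length ps \<le> link_length qs" if "covering_trail n qs" for qs
      \<comment> \<open>For \<open>n = 2\<close> the general bound is one short, and the special
        bound replaces it.\<close>
      using ps(2) covering_trail_lower_bound[OF that] covering_trail_2_lower_bound[of qs] that
      by (cases "n = 2") auto
  qed
  ultimately show ?thesis by auto
qed

end
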